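(* There is an absolute constant $c>0$ such that the following hold. (i) For every $\alpha\in[1/2,2]$ and every integer $N\geq 10$ there exists a uniformly convex sequence $\{a_n\}_{n=1}^N$ (with parameter $N$) such that $|\{a_n\}_{n=1}^N\cap N^{-\alpha}\mathbb{Z}|\geq c N^{\frac{\alpha+1}{3}}$. (ii) For every $\alpha\in[0,1/2]$ and every integer $N\geq 10$ there exists a uniformly convex sequence $\{a_n\}_{n=1}^N$ (with parameter $N$) such that $|\{a_n\}_{n=1}^N\cap N^{-\alpha}\mathbb{Z}|\geq c N^{\alpha}$. (iii) Conversely, for every $\epsilon>0$ there exists $C_\epsilon>0$ such that for every integer $N\geq 1$, every uniformly convex sequence $\{a_n\}_{n=1}^N$ (with parameter $N$) and every $\alpha\in[0,2]$, \[ |\{a_n\}_{n=1}^N\cap N^{-\alpha}\mathbb{Z}| \leq \begin{cases} C_\epsilon N^\epsilon N^{\frac{\alpha+1}{3}} & \text{if } \alpha\in[\frac12,2],\\ 100 N^{\alpha} & \text{if } \alpha\in[0,\frac12].\end{cases} \]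
   Context: A real sequence $\{a_n\}_{n=1}^N$ is called uniformly convex (with parameter $N$) if for all admissible $n$: $a_{n+1}-a_n\in[\frac{1}{4N},\frac{4}{N}]$ and $(a_{n+2}-a_{n+1})-(a_{n+1}-a_n)\in[\frac{1}{4N^2},\frac{4}{N^2}]$. $|\cdot|$ denotes cardinality of a set; $\{a_n\}_{n=1}^N$ is viewed as the set of its values. *)

theory Defs
  imports Complex_Main
begin

definition unif_convex :: "nat \<Rightarrow> (nat \<Rightarrow> real) \<Rightarrow> bool" where
  "unif_convex N a \<longleftrightarrow>
     (\<forall>n. 1 \<le> n \<and> n + 1 \<le> N \<longrightarrow>
        a (n+1) - a n \<in> {1 / (4 * real N) .. 4 / real N}) \<and>
     (\<forall>n. 1 \<le> n \<and> n + 2 \<le> N \<longrightarrow>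
        (a (n+2) - a (n+1)) - (a (n+1) - a n) \<in> {1 / (4 * real N ^ 2) .. 4 / real N ^ 2})"

definition scaled_lattice :: "nat \<Rightarrow> real \<Rightarrow> real set" where
  "scaled_lattice N \<alpha> = {of_int k * real N powr (- \<alpha>) | k. True}"

definition lattice_count :: "nat \<Rightarrow> (nat \<Rightarrow> real) \<Rightarrow> real \<Rightarrow> nat" where
  "lattice_count N a \<alpha> = card (a ` {1..N} \<inter> scaled_lattice N \<alpha>)"

end

theory Submission
  imports Defs "HOL-Analysis.Kronecker_Approximation_Theorem"
begin

text \<open>
  Upper bound: the lattice points on the graph of a uniformly convex sequence are the vertices of a
  strictly convex lattice chain in an \<open>N\<close> by \<open>4N\<^sup>\<alpha>\<close> box. Consecutive difference vectors are pairwise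
  distinct, their coordinates sum to at most \<open>N\<close> and \<open>4N\<^sup>\<alpha>\<close>, and few distinct integer vectors are
  short; hence there are \<open>O(N powr ((\<alpha> + 1) / 3))\<close> of them, without any loss of \<open>N\<^sup>\<epsilon>\<close>.

  Lower bounds: a quadratic sequence may be moved by \<open>O(W\<^sup>2/N\<^sup>2)\<close> at points that are \<open>4W\<close>-separated
  by adding bumps of width \<open>W\<close>, so it is enough to find many separated points at which the quadratic
  is that close to the lattice. For \<open>\<alpha> \<le> 1/2\<close> these are the places where it crosses every 66th
  lattice level. For \<open>\<alpha> \<ge> 1/2\<close> put \<open>P = N powr ((2 - \<alpha>) / 3)\<close>, cut the index set into blocks of
  length about \<open>256 P\<close>, and approximate the slope at the start of each block (in lattice units) by
  a fraction \<open>q/p\<close> with \<open>p \<le> 2P\<close>. If \<open>p > P/64\<close>, the first \<open>p\<close> terms of the block run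
  through all residues modulo \<open>p\<close> up to \<open>O(1/P)\<close> and one of them is within \<open>67/P\<close> of an
  integer. Slopes that only admit smaller denominators occur in a small proportion of blocks.
\<close>

section \<open>Gaps and differences of uniformly convex sequences\<close>

lemma unif_convex_gap:
  assumes "unif_convex N a" "1 \<le> i" "i \<le> j" "j \<le> N"
  shows "real (j - i) / (4 * real N) \<le> a j - a i \<and> a j - a i \<le> 4 * real (j - i) / real N"
  using assms(3,4)
proof (induction j rule: dec_induct)
  case base
  then show ?case by simp
next
  case (step n)
  have "a (n+1) - a n \<in> {1 / (4 * real N) .. 4 / real N}"
    using assms(1,2) step unfolding unif_convex_def by (metis Suc_eq_plus1 le_trans)
  moreover have "real (Suc n - i) = real (n - i) + 1"
    using step by (simp add: of_nat_diff)
  ultimately show ?case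
    using step.IH step.prems by (simp add: add_divide_distrib ring_distribs)
qed

lemma unif_convex_less:
  assumes "unif_convex N a" "1 \<le> i" "i < j" "j \<le> N"
  shows "a i < a j"
proof -
  have "0 < real (j - i) / (4 * real N)" using assms by simp
  then show ?thesis using unif_convex_gap[OF assms(1,2) _ assms(4)] assms(3) by fastforce
qed

lemma unif_convex_inj_on:
  assumes "unif_convex N a"
  shows "inj_on a {1..N}"
  by (rule linorder_inj_onI) (use unif_convex_less[OF assms] in force)+

lemma unif_convex_step_less:
  assumes "unif_convex N a" "1 \<le> i" "i < j" "j < N"
  shows "a (i+1) - a i < a (j+1) - a j"
proof -
  have *: "a (Suc n) - a n < a (Suc (Suc n)) - a (Suc n)" if "1 \<le> n" "n + 2 \<le> N" for n
  proof -
    have "0 < 1 / (4 * real N ^ 2)" using that by simp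
    moreover have "1 / (4 * real N ^ 2) \<le> (a (Suc (Suc n)) - a (Suc n)) - (a (Suc n) - a n)"
      using assms(1) that unfolding unif_convex_def by fastforce
    ultimately show ?thesis by linarith
  qed
  have "Suc i \<le> j" using assms by simp
  then show ?thesis using assms(4)
  proof (induction j rule: dec_induct)
    case base
    then show ?case using * assms(2) by simp
  next
    case (step n)
    then show ?case using *[of n] assms(2) by fastforce
  qed
qed

text \<open>Sums \<open>p\<close> one-step comparisons. The strictness makes chords of equal
  horizontal length rise differently, so the difference vectors in the upper bound are pairwise
  distinct.\<close>

lemma unif_convex_shift_less:
  assumes "unif_convex N a" "1 \<le> i" "i < j" "j + p \<le> N" "0 < p"
  shows "a (i+p) - a i < a (j+p) - a j"
proof -
  have "Suc 0 \<le> p" using assms by simp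
  then show ?thesis using assms(4)
  proof (induction p rule: dec_induct)
    case base
    then show ?case using unif_convex_step_less[OF assms(1-3)] by simp
  next
    case (step n)
    have "a (i+n+1) - a (i+n) < a (j+n+1) - a (j+n)"
      using step assms by (intro unif_convex_step_less[OF assms(1)]) auto
    then show ?case using step by simp
  qed
qed

text \<open>Injectivity of \<open>a\<close> on the index range allows indices to be counted in place
  of values.\<close>

lemma lattice_count_eq:
  assumes "unif_convex N a"
  shows "lattice_count N a \<alpha> = card {n \<in> {1..N}. a n \<in> scaled_lattice N \<alpha>}"
proof -
  have "a ` {1..N} \<inter> scaled_lattice N \<alpha> = a ` {n \<in> {1..N}. a n \<in> scaled_lattice N \<alpha>}" by auto
  moreover have "inj_on a {n \<in> {1..N}. a n \<in> scaled_lattice N \<alpha>}"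
    using unif_convex_inj_on[OF assms] by (rule inj_on_subset) auto
  ultimately show ?thesis unfolding lattice_count_def by (simp add: card_image)
qed

section \<open>Upper bounds by counting distinct integer vectors\<close>

text \<open>Markov's inequality for the counting measure on \<open>I\<close>.\<close>

lemma card_large_le:
  fixes f :: "'a \<Rightarrow> real"
  assumes "finite I" "\<And>i. i \<in> I \<Longrightarrow> 0 \<le> f i" "sum f I \<le> B" "0 < X"
  shows "real (card {i \<in> I. X < f i}) \<le> B / X"
proof -
  have "real (card {i \<in> I. X < f i}) * X \<le> (\<Sum>i\<in>{i \<in> I. X < f i}. f i)"
    by (rule order_trans[OF _ sum_mono[of _ "\<lambda>_. X"]]) auto
  also have "\<dots> \<le> sum f I" using assms by (intro sum_mono2) auto
  finally show ?thesis using assms by (simp add: field_simps)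
qed

text \<open>Indices whose vector lies in the box \<open>X\<close> by \<open>Y\<close> inject into
  its at most \<open>X * Y\<close> positive integer points. Any other index has a large coordinate,
  and Markov's inequality bounds those by \<open>A / X\<close> and \<open>B / Y\<close>.\<close>

lemma card_le_of_distinct_increments:
  fixes p q :: "nat \<Rightarrow> int"
  assumes inj: "inj_on (\<lambda>i. (p i, q i)) {..<m}"
    and pos: "\<And>i. i < m \<Longrightarrow> 0 < p i \<and> 0 < q i"
    and sums: "(\<Sum>i<m. real_of_int (p i)) \<le> A" "(\<Sum>i<m. real_of_int (q i)) \<le> B"
    and XY: "0 < X" "0 < Y"
  shows "real m \<le> X * Y + A / X + B / Y"
proof -
  let ?G = "{i\<in>{..<m}. real_of_int (p i) \<le> X \<and> real_of_int (q i) \<le> Y}"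
  let ?H1 = "{i\<in>{..<m}. X < real_of_int (p i)}" and ?H2 = "{i\<in>{..<m}. Y < real_of_int (q i)}"
  have "card ?G \<le> card ({1..\<lfloor>X\<rfloor>} \<times> {1..\<lfloor>Y\<rfloor>})"
  proof (rule card_inj_on_le)
    show "inj_on (\<lambda>i. (p i, q i)) ?G" using inj by (rule inj_on_subset) auto
    show "(\<lambda>i. (p i, q i)) ` ?G \<subseteq> {1..\<lfloor>X\<rfloor>} \<times> {1..\<lfloor>Y\<rfloor>}" using pos by (force simp: le_floor_iff)
  qed simp
  also have "real \<dots> = of_int \<lfloor>X\<rfloor> * of_int \<lfloor>Y\<rfloor>" using XY by (simp add: card_cartesian_product)
  also have "\<dots> \<le> X * Y" using XY by (intro mult_mono) auto
  finally have G: "real (card ?G) \<le> X * Y" by simp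
  have H: "real (card ?H1) \<le> A / X" "real (card ?H2) \<le> B / Y"
    using pos sums XY by (intro card_large_le; simp add: less_imp_le)+
  have "card {..<m} \<le> card (?G \<union> ?H1 \<union> ?H2)" by (rule card_mono) auto
  also have "\<dots> \<le> card ?G + card ?H1 + card ?H2"
    by (meson add_le_mono1 card_Un_le le_trans)
  finally show ?thesis using G H by simp
qed

lemma lattice_count_upper:
  assumes uc: "unif_convex N a" and N: "N \<ge> 1" and \<alpha>: "0 \<le> \<alpha>"
  shows "real (lattice_count N a \<alpha>) \<le> 7 * real N powr ((\<alpha> + 1) / 3)"
proof -
  define A where "A = {n \<in> {1..N}. a n \<in> scaled_lattice N \<alpha>}"
  define T where "T = real N powr ((\<alpha> + 1) / 3)"
  define d where "d = real N powr (-\<alpha>)"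
  define m where "m = card A"
  define e where "e = (\<lambda>i. sorted_list_of_set A ! i)"
  have T1: "T \<ge> 1" using N \<alpha> by (simp add: T_def ge_one_powr_ge_zero)
  have d0: "d > 0" using N by (simp add: d_def)
  have "finite A" by (simp add: A_def)
  have eA: "e i \<in> A" if "i < m" for i
    using that \<open>finite A\<close> nth_mem[of i "sorted_list_of_set A"] by (simp add: e_def m_def)
  have emono: "e i < e j" if "i < j" "j < m" for i j
    using that strict_sorted_list_of_set[of A] sorted_wrt_nth_less[of "(<)" "sorted_list_of_set A" i j]
    by (simp add: e_def m_def)
  have eb: "1 \<le> e i" "e i \<le> N" if "i < m" for i using eA[OF that] by (auto simp: A_def)
  have "\<forall>n\<in>A. \<exists>k. a n = of_int k * d" by (auto simp: A_def scaled_lattice_def d_def)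
  then obtain k where k: "\<And>n. n \<in> A \<Longrightarrow> a n = of_int (k n) * d" by metis
  define p where "p = (\<lambda>i. int (e (Suc i)) - int (e i))"
  define q where "q = (\<lambda>i. k (e (Suc i)) - k (e i))"
  have qd: "real_of_int (q i) * d = a (e (Suc i)) - a (e i)" if "Suc i < m" for i
    using that k eA by (simp add: q_def algebra_simps)
  \<comment> \<open>The box sides are the coordinate sums divided by \<open>T\<close>, up to the
    factor 4. Since \<open>T ^ 3\<close> equals \<open>N powr (\<alpha> + 1)\<close>, the three
    terms become \<open>T\<close>, \<open>T\<close> and \<open>4 * T\<close>.\<close>
  have "real (m - 1) \<le> (real N / T) * (real N powr \<alpha> / T) + real N / (real N / T)
      + 4 * real N powr \<alpha> / (real N powr \<alpha> / T)"
  proof (rule card_le_of_distinct_increments[where p = p and q = q])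
    show "inj_on (\<lambda>i. (p i, q i)) {..<m-1}"
    proof (rule linorder_inj_onI)
      fix i j assume ij: "i < j" "i \<in> {..<m-1}" "j \<in> {..<m-1}"
      show "(p i, q i) \<noteq> (p j, q j)"
      proof
        assume eq: "(p i, q i) = (p j, q j)"
        \<comment> \<open>Equal vectors would give two chords of the same length \<open>h\<close>
          and the same rise at different starting indices, against
          \<open>unif_convex_shift_less\<close>.\<close>
        define h where "h = e (Suc i) - e i"
        have "e i < e (Suc i)" "e j < e (Suc j)" "e i < e j" using ij emono by auto
        then have h: "e (Suc i) = e i + h" "0 < h" by (auto simp: h_def)
        then have h': "e (Suc j) = e j + h" using eq \<open>e j < e (Suc j)\<close> by (simp add: p_def)
        have "a (e i + h) - a (e i) < a (e j + h) - a (e j)"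
          using eb[of i] eb[of "Suc j"] ij h h' \<open>e i < e j\<close> by (intro unif_convex_shift_less[OF uc]) auto
        moreover have "a (e (Suc i)) - a (e i) = a (e (Suc j)) - a (e j)"
          using eq qd[of i] qd[of j] ij by (simp add: p_def)
        ultimately show False using h h' by simp
      qed
    qed auto
    show "0 < p i \<and> 0 < q i" if "i < m - 1" for i
    proof
      have lt: "e i < e (Suc i)" using that emono by auto
      then show "0 < p i" by (simp add: p_def)
      have "a (e i) < a (e (Suc i))"
        using that eb[of i] eb[of "Suc i"] lt by (intro unif_convex_less[OF uc]) auto
      then have "0 < real_of_int (q i) * d" using qd that by auto
      then show "0 < q i" using d0 by (simp add: zero_less_mult_iff)
    qed
    show "(\<Sum>i<m-1. real_of_int (p i)) \<le> real N"
    \<comment> \<open>For \<open>m = 0\<close> the sum is empty, and \<open>e 0\<close> need not be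
      an element of \<open>A\<close>.\<close>
    proof (cases "m = 0")
      case False
      have "(\<Sum>i<m-1. real_of_int (p i)) = real (e (m-1)) - real (e 0)"
        using sum_lessThan_telescope[of "\<lambda>i. real (e i)" "m-1"] by (simp add: p_def)
      also have "\<dots> \<le> real N" using eb[of "m-1"] False by (simp add: le_diff_eq)
      finally show ?thesis .
    qed simp
    show "(\<Sum>i<m-1. real_of_int (q i)) \<le> 4 * real N powr \<alpha>"
    proof (cases "m = 0")
      case False
      have "(\<Sum>i<m-1. real_of_int (q i)) * d = a (e (m-1)) - a (e 0)"
        using sum_lessThan_telescope[of "\<lambda>i. real_of_int (k (e i))" "m-1"] False k eA
        by (simp add: q_def left_diff_distrib)
      also have "\<dots> \<le> 4 * real (e (m-1) - e 0) / real N"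
      proof -
        have "e 0 \<le> e (m-1)" using emono[of 0 "m-1"] False by (cases "m = 1") auto
        then show ?thesis using unif_convex_gap[OF uc, of "e 0" "e (m-1)"] eb[of 0] eb[of "m-1"] False by auto
      qed
      also have "\<dots> \<le> 4 * real N / real N"
        using eb[of "m-1"] False by (intro divide_right_mono mult_left_mono) auto
      finally have "(\<Sum>i<m-1. real_of_int (q i)) * d \<le> 4" using N by simp
      then show ?thesis using d0 N by (simp add: d_def powr_minus field_simps)
    qed simp
  qed (use N T1 in auto)
  also have "(real N / T) * (real N powr \<alpha> / T) = T"
  proof -
    have "(\<alpha> + 1) / 3 + (\<alpha> + 1) / 3 + (\<alpha> + 1) / 3 = \<alpha> + 1" by (simp add: field_simps)
    then have "T * T * T = real N powr (\<alpha> + 1)" unfolding T_def by (metis powr_add)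
    also have "\<dots> = real N * real N powr \<alpha>" using N by (simp add: powr_add)
    finally show ?thesis using T1 by (simp add: field_simps)
  qed
  finally have "real (m - 1) \<le> 6 * T" using N T1 by (simp add: field_simps)
  \<comment> \<open>\<open>m\<close> points have only \<open>m - 1\<close> increments; the extra
    point is absorbed by \<open>1 \<le> T\<close>.\<close>
  then have "real m \<le> 7 * T" using T1 by simp
  then show ?thesis using lattice_count_eq[OF uc] by (simp add: T_def m_def A_def)
qed

text \<open>All values lie in an interval of length at most 4, which holds at most
  \<open>4 / d + 1\<close> multiples of \<open>d\<close>. For \<alpha> at most 1/2 the exponent
  \<alpha> does not exceed \<open>(\<alpha> + 1) / 3\<close>, so this is the bound wanted
  there.\<close>

lemma lattice_count_upper_trivial:
  assumes uc: "unif_convex N a" and N: "N \<ge> 1" and \<alpha>: "0 \<le> \<alpha>"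
  shows "real (lattice_count N a \<alpha>) \<le> 5 * real N powr \<alpha>"
proof -
  define d where "d = real N powr (-\<alpha>)"
  have d0: "d > 0" using N by (simp add: d_def)
  define L where "L = a 1 / d"
  define U where "U = a N / d"
  have "a ` {1..N} \<inter> scaled_lattice N \<alpha> \<subseteq> (\<lambda>k. of_int k * d) ` {\<lceil>L\<rceil>..\<lfloor>U\<rfloor>}"
  proof
    fix y assume "y \<in> a ` {1..N} \<inter> scaled_lattice N \<alpha>"
    then obtain n k where nk: "1 \<le> n" "n \<le> N" "y = a n" "y = of_int k * d"
      by (auto simp: scaled_lattice_def d_def)
    have "a 1 \<le> a n" "a n \<le> a N"
      using unif_convex_less[OF uc, of 1 n] unif_convex_less[OF uc, of n N] nk
      by (cases "n = 1"; cases "n = N"; force)+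
    then have "L \<le> of_int k" "of_int k \<le> U" using nk d0 by (auto simp: L_def U_def field_simps)
    then show "y \<in> (\<lambda>k. of_int k * d) ` {\<lceil>L\<rceil>..\<lfloor>U\<rfloor>}" using nk(4)
      by (intro image_eqI[of _ _ k]) (auto simp: ceiling_le_iff le_floor_iff)
  qed
  then have "card (a ` {1..N} \<inter> scaled_lattice N \<alpha>) \<le> card {\<lceil>L\<rceil>..\<lfloor>U\<rfloor>}"
    by (meson surj_card_le finite_atLeastAtMost_int)
  moreover have "real (card {\<lceil>L\<rceil>..\<lfloor>U\<rfloor>}) \<le> max 0 (U - L + 1)"
    by (simp add: nat_eq_iff2) linarith
  moreover have "a N - a 1 \<le> 4 * real (N - 1) / real N"
    using unif_convex_gap[OF uc, of 1 N] N by simp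
  moreover have "4 * real (N - 1) / real N \<le> 4" using N by (simp add: field_simps)
  ultimately have "a N - a 1 \<le> 4" "real (lattice_count N a \<alpha>) \<le> max 0 (U - L + 1)"
    by (auto simp: lattice_count_def)
  then have "U - L \<le> 4 / d" using d0 by (simp add: U_def L_def divide_right_mono flip: diff_divide_distrib)
  moreover have "4 / d = 4 * real N powr \<alpha>" by (simp add: d_def powr_minus field_simps)
  moreover have "1 \<le> real N powr \<alpha>" using N \<alpha> by (simp add: ge_one_powr_ge_zero)
  ultimately show ?thesis using \<open>real (lattice_count N a \<alpha>) \<le> max 0 (U - L + 1)\<close> by linarith
qed

section \<open>The quadratic model sequence and its perturbation by bumps\<close>

text \<open>Up to index \<open>N\<close> its steps lie between \<open>1 / N\<close> and
  \<open>2 / N\<close>, and its second differences equal \<open>1 / N ^ 2\<close>. Both are well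
  inside the allowed ranges, and the slack pays for the bumps.\<close>

definition base_seq :: "nat \<Rightarrow> nat \<Rightarrow> real" where
  "base_seq N n = real n / real N + (real n)\<^sup>2 / (2 * (real N)\<^sup>2)"

lemma base_seq_step:
  assumes "n + 1 \<le> N"
  shows "1 / real N \<le> base_seq N (n+1) - base_seq N n" "base_seq N (n+1) - base_seq N n \<le> 2 / real N"
proof -
  have b: "base_seq N (n+1) - base_seq N n = (1 + (real n + 1/2) / real N) / real N"
    using assms by (simp add: base_seq_def field_simps power2_eq_square)
  have "(real n + 1/2) / real N \<le> 1" using assms by (simp add: field_simps)
  then show "1 / real N \<le> base_seq N (n+1) - base_seq N n" "base_seq N (n+1) - base_seq N n \<le> 2 / real N"
    unfolding b by (intro divide_right_mono; simp)+
qed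

text \<open>Squaring the positive part makes the truncated parabola differentiable with Lipschitz
  derivative, which is enough smoothness for second differences of order
  \<open>h ^ 2\<close>.\<close>

definition bump :: "real \<Rightarrow> real" where
  "bump x = (max 0 (1 - x\<^sup>2))\<^sup>2"

lemma bump_0 [simp]: "bump 0 = 1"
  by (simp add: bump_def)

lemma bump_eq_0: "1 \<le> \<bar>x\<bar> \<Longrightarrow> bump x = 0"
  using abs_le_square_iff[of 1 x] by (simp add: bump_def)

text \<open>This is the first-order Taylor remainder at \<open>y\<close> of the squared positive
  part, a convex function whose derivative \<open>2 * max 0 y\<close> has Lipschitz constant
  2.\<close>

lemma pos_part_sq_diff:
  fixes y z :: real
  shows "0 \<le> (max 0 z)\<^sup>2 - (max 0 y)\<^sup>2 - 2 * max 0 y * (z - y)"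
    and "(max 0 z)\<^sup>2 - (max 0 y)\<^sup>2 - 2 * max 0 y * (z - y) \<le> (z - y)\<^sup>2"
proof -
  consider "0 \<le> y" "0 \<le> z" | "0 \<le> y" "z < 0" | "y < 0" "0 \<le> z" | "y < 0" "z < 0" by linarith
  then have "0 \<le> (max 0 z)\<^sup>2 - (max 0 y)\<^sup>2 - 2 * max 0 y * (z - y) \<and>
    (max 0 z)\<^sup>2 - (max 0 y)\<^sup>2 - 2 * max 0 y * (z - y) \<le> (z - y)\<^sup>2"
  proof cases
    case 1
    then have "(max 0 z)\<^sup>2 - (max 0 y)\<^sup>2 - 2 * max 0 y * (z - y) = (z - y)\<^sup>2"
      by (simp add: max_def power2_eq_square algebra_simps)
    then show ?thesis by simp
  next
    case 2
    have "y * (z * 2) \<le> y * y" using 2 by (intro mult_left_mono) auto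
    then show ?thesis using 2 by (simp add: max_def power2_eq_square algebra_simps)
  next
    case 3
    then have "y * z \<le> 0" by (simp add: mult_le_0_iff)
    then show ?thesis using 3 by (simp add: max_def power2_eq_square algebra_simps)
  next
    case 4
    then show ?thesis by (simp add: max_def)
  qed
  then show "0 \<le> (max 0 z)\<^sup>2 - (max 0 y)\<^sup>2 - 2 * max 0 y * (z - y)"
    and "(max 0 z)\<^sup>2 - (max 0 y)\<^sup>2 - 2 * max 0 y * (z - y) \<le> (z - y)\<^sup>2" by auto
qed

text \<open>Factor the difference of squares: the sum of the positive parts is at most 2, the
  positive part is 1-Lipschitz, and \<open>\<bar>2 * x + h\<bar>\<close> is at most 3 unless both
  points are outside the support.\<close>

lemma bump_diff_le:
  assumes h: "0 < h" "h \<le> 1/4"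
  shows "\<bar>bump (x + h) - bump x\<bar> \<le> 6 * h"
proof (cases "1 \<le> \<bar>x\<bar> \<and> 1 \<le> \<bar>x + h\<bar>")
  case True
  then show ?thesis using h by (simp add: bump_eq_0)
next
  case False
  define y where "y = 1 - x\<^sup>2"
  define z where "z = 1 - (x + h)\<^sup>2"
  define r where "r = max 0 z + max 0 y"
  have "max 0 (1 - u\<^sup>2) \<le> 1" for u :: real by simp
  from this[of x] this[of "x + h"] have r: "0 \<le> r" "r \<le> 2"
    unfolding r_def y_def z_def by linarith+
  have "bump (x + h) - bump x = (max 0 z - max 0 y) * r"
    unfolding bump_def z_def[symmetric] y_def[symmetric] r_def by (simp add: power2_eq_square algebra_simps)
  then have "\<bar>bump (x + h) - bump x\<bar> = \<bar>max 0 z - max 0 y\<bar> * r"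
    using r(1) by (simp add: abs_mult)
  also have "\<dots> \<le> \<bar>z - y\<bar> * 2" using r by (intro mult_mono) auto
  also have "\<bar>z - y\<bar> = \<bar>2 * x + h\<bar> * h"
  proof -
    have "z - y = - ((2 * x + h) * h)" by (simp add: y_def z_def power2_eq_square algebra_simps)
    then show ?thesis using h by (simp add: abs_mult)
  qed
  also have "\<dots> \<le> 3 * h" using False h by (intro mult_right_mono) auto
  finally show ?thesis by simp
qed

text \<open>Adds the remainders of \<open>pos_part_sq_diff\<close> at \<open>y\<close> towards
  \<open>v\<close> and \<open>w\<close>. The linear parts nearly cancel, because
  \<open>v - y\<close> and \<open>w - y\<close> sum to \<open>- 2 * h ^ 2\<close>; what survives of
  them is \<open>- 4 * Y\<close>.\<close>

lemma bump_second_diff_le: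
  assumes h: "0 < h" "h \<le> 1/4"
  shows "\<bar>bump (x + h) - 2 * bump x + bump (x - h)\<bar> \<le> 16 * h\<^sup>2"
proof (cases "1 \<le> \<bar>x\<bar> \<and> 1 \<le> \<bar>x + h\<bar> \<and> 1 \<le> \<bar>x - h\<bar>")
  case True
  then show ?thesis using h by (simp add: bump_eq_0)
next
  case False
  define y where "y = 1 - x\<^sup>2"
  define v where "v = 1 - (x + h)\<^sup>2"
  define w where "w = 1 - (x - h)\<^sup>2"
  have vw: "v - y = - 2 * x * h - h\<^sup>2" "w - y = 2 * x * h - h\<^sup>2"
    by (simp_all add: y_def v_def w_def power2_eq_square algebra_simps)
  define D where "D = bump (x + h) - 2 * bump x + bump (x - h)"
  define Y where "Y = max 0 y * h\<^sup>2"
  have DY: "D + 4 * Y = ((max 0 v)\<^sup>2 - (max 0 y)\<^sup>2 - 2 * max 0 y * (v - y))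
     + ((max 0 w)\<^sup>2 - (max 0 y)\<^sup>2 - 2 * max 0 y * (w - y))"
    by (simp add: D_def Y_def bump_def vw flip: y_def v_def w_def) (simp add: algebra_simps)
  then have lower: "0 \<le> D + 4 * Y" using pos_part_sq_diff(1)[of v y] pos_part_sq_diff(1)[of w y] by linarith
  have "D + 4 * Y \<le> (v - y)\<^sup>2 + (w - y)\<^sup>2"
    using DY pos_part_sq_diff(2)[of v y] pos_part_sq_diff(2)[of w y] by linarith
  also have "\<dots> = (8 * x\<^sup>2 + 2 * h\<^sup>2) * h\<^sup>2"
    unfolding vw by (simp add: power2_eq_square algebra_simps)
  also have "\<dots> \<le> 16 * h\<^sup>2"
  proof (rule mult_right_mono)
    have "\<bar>x\<bar> \<le> 5/4" using False h by auto
    then have "x\<^sup>2 \<le> (5/4)\<^sup>2" using abs_le_square_iff[of x "5/4"] by simp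
    moreover have "h\<^sup>2 \<le> (1/4)\<^sup>2" using h by (intro power_mono) auto
    ultimately show "8 * x\<^sup>2 + 2 * h\<^sup>2 \<le> 16" by (simp add: power2_eq_square)
  qed simp
  finally have upper: "D + 4 * Y \<le> 16 * h\<^sup>2" .
  have "0 \<le> Y" "Y \<le> 1 * h\<^sup>2" unfolding Y_def by (simp, intro mult_right_mono) (auto simp: y_def)
  then show ?thesis using lower upper unfolding D_def[symmetric] by (simp add: abs_le_iff)
qed

text \<open>Meant for bumps with separated supports: at most one term survives, so the bound for one
  bump holds for the sum, however large \<open>T\<close> is.\<close>

lemma abs_sum_le_of_at_most_one:
  fixes u :: "'a \<Rightarrow> real"
  assumes "finite T" and one: "\<And>s t. s \<in> T \<Longrightarrow> t \<in> T \<Longrightarrow> u s \<noteq> 0 \<Longrightarrow> u t \<noteq> 0 \<Longrightarrow> s = t"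
    and "\<And>t. t \<in> T \<Longrightarrow> \<bar>u t\<bar> \<le> B" "0 \<le> B"
  shows "\<bar>sum u T\<bar> \<le> B"
proof (cases "\<exists>t\<in>T. u t \<noteq> 0")
  case True
  then obtain t where t: "t \<in> T" "u t \<noteq> 0" by blast
  have "sum u T = sum u {t}" using one t assms(1) by (intro sum.mono_neutral_right) auto
  then show ?thesis using assms(3)[OF t(1)] by simp
next
  case False
  then have "sum u T = 0" by (intro sum.neutral) auto
  then show ?thesis using assms by simp
qed

text \<open>Bumps of width \<open>W\<close> and height at most \<open>E\<close> change first
  differences by at most \<open>6 * E / W\<close> and second differences by at most
  \<open>16 * E / W ^ 2\<close>. The constant 32 in \<open>E\<close> turns the latter into
  \<open>1 / (2 * N ^ 2)\<close>, and \<open>W \<le> N\<close> keeps the former below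
  \<open>1 / (4 * N)\<close>.\<close>

lemma unif_convex_through:
  fixes W :: real
  assumes N: "N \<ge> 1" and W: "4 \<le> W" "W \<le> real N" and T: "finite T"
    and near: "\<And>t. t \<in> T \<Longrightarrow> \<bar>y t - base_seq N t\<bar> \<le> W\<^sup>2 / (32 * (real N)\<^sup>2)"
    and sep: "\<And>s t. s \<in> T \<Longrightarrow> t \<in> T \<Longrightarrow> s < t \<Longrightarrow> 4 * W \<le> real t - real s"
  shows "\<exists>a. unif_convex N a \<and> (\<forall>t\<in>T. a t = y t)"
proof -
  define E where "E = W\<^sup>2 / (32 * (real N)\<^sup>2)"
  define \<epsilon> where "\<epsilon> t = y t - base_seq N t" for t
  define \<phi> where "\<phi> t n = bump ((real n - real t) / W)" for t n
  define g where "g n = (\<Sum>t\<in>T. \<epsilon> t * \<phi> t n)" for n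
  define a where "a n = base_seq N n + g n" for n
  have E0: "0 \<le> E" by (simp add: E_def)
  have \<epsilon>E: "\<bar>\<epsilon> t\<bar> \<le> E" if "t \<in> T" for t using near[OF that] by (simp add: \<epsilon>_def E_def)
  have sep': "s = t" if "s \<in> T" "t \<in> T" "\<bar>real s - real t\<bar> < 4 * W" for s t
    using sep[of s t] sep[of t s] that by (cases s t rule: linorder_cases) auto
  have zero: "\<phi> t n = 0" if "W \<le> \<bar>real n - real t\<bar>" for t n
    unfolding \<phi>_def using that W by (intro bump_eq_0) (simp add: abs_divide field_simps)
  have h: "0 < 1 / W" "1 / W \<le> 1/4" using W by (auto simp: field_simps)
  have at: "a t = y t" if t: "t \<in> T" for t
  proof -
    have "g t = (\<Sum>s\<in>{t}. \<epsilon> s * \<phi> s t)" unfolding g_def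
    proof (rule sum.mono_neutral_right)
      show "\<forall>s\<in>T - {t}. \<epsilon> s * \<phi> s t = 0"
        using sep' t W by (force intro!: mult_eq_0_iff[THEN iffD2] disjI2 zero)
    qed (use t T in auto)
    then show ?thesis by (simp add: a_def \<epsilon>_def \<phi>_def)
  qed
  have shift: "(real (n + 1) - real t) / W = (real n - real t) / W + 1 / W" for n t
    by (simp add: add_divide_distrib diff_divide_distrib)
  have g1: "\<bar>g (n+1) - g n\<bar> \<le> 1 / (4 * real N)" for n
  proof -
    have "g (n+1) - g n = (\<Sum>t\<in>T. \<epsilon> t * (\<phi> t (n+1) - \<phi> t n))"
      by (simp add: g_def sum_subtractf right_diff_distrib)
    also have "\<bar>\<dots>\<bar> \<le> E * (6 * (1 / W))"
    proof (rule abs_sum_le_of_at_most_one[OF T])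
      fix s t assume st: "s \<in> T" "t \<in> T" "\<epsilon> s * (\<phi> s (n+1) - \<phi> s n) \<noteq> 0" "\<epsilon> t * (\<phi> t (n+1) - \<phi> t n) \<noteq> 0"
      have "\<bar>real n - real s\<bar> < W + 1" if "\<epsilon> s * (\<phi> s (n+1) - \<phi> s n) \<noteq> 0" for s
        using that zero[of n s] zero[of "n+1" s] by (cases "W \<le> \<bar>real n - real s\<bar>"; cases "W \<le> \<bar>real (n+1) - real s\<bar>") auto
      from this[OF st(3)] this[OF st(4)] show "s = t" using st W by (intro sep') auto
    next
      fix t assume t: "t \<in> T"
      have "\<bar>\<phi> t (n+1) - \<phi> t n\<bar> \<le> 6 * (1 / W)"
        unfolding \<phi>_def shift by (rule bump_diff_le[OF h])
      then show "\<bar>\<epsilon> t * (\<phi> t (n+1) - \<phi> t n)\<bar> \<le> E * (6 * (1 / W))"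
        unfolding abs_mult using \<epsilon>E[OF t] E0 by (intro mult_mono) auto
    qed (use E0 W in auto)
    also have "\<dots> = (6 * W / real N) / (32 * real N)" using W by (simp add: E_def power2_eq_square)
    also have "\<dots> \<le> 8 / (32 * real N)" using W N by (intro divide_right_mono) (auto simp: field_simps)
    finally show ?thesis by simp
  qed
  have g2: "\<bar>(g (n+2) - g (n+1)) - (g (n+1) - g n)\<bar> \<le> 1 / (2 * (real N)\<^sup>2)" for n
  proof -
    define u where "u t = \<phi> t (n+2) - 2 * \<phi> t (n+1) + \<phi> t n" for t
    have "(g (n+2) - g (n+1)) - (g (n+1) - g n) = (\<Sum>t\<in>T. \<epsilon> t * u t)"
      by (simp add: g_def u_def sum_subtractf sum.distrib algebra_simps sum_distrib_left)
    also have "\<bar>\<dots>\<bar> \<le> E * (16 * (1 / W)\<^sup>2)"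
    proof (rule abs_sum_le_of_at_most_one[OF T])
      fix s t assume st: "s \<in> T" "t \<in> T" "\<epsilon> s * u s \<noteq> 0" "\<epsilon> t * u t \<noteq> 0"
      \<comment> \<open>A second difference sees the window from \<open>n\<close> to
        \<open>n + 2\<close>. Two bumps active in it have centres less than \<open>2 * W + 4\<close>
        apart, which is at most \<open>3 * W\<close> by \<open>4 \<le> W\<close>.\<close>
      have "\<bar>real n - real s\<bar> < W + 2" if "\<epsilon> s * u s \<noteq> 0" for s
      proof (rule ccontr)
        assume "\<not> \<bar>real n - real s\<bar> < W + 2"
        then have "W \<le> \<bar>real n - real s\<bar>" "W \<le> \<bar>real (n+1) - real s\<bar>" "W \<le> \<bar>real (n+2) - real s\<bar>" by auto
        then show False using that zero by (simp add: u_def)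
      qed
      from this[OF st(3)] this[OF st(4)] show "s = t" using st W by (intro sep') auto
    next
      fix t assume t: "t \<in> T"
      have eqs: "(real (n + 2) - real t) / W = (real (n+1) - real t) / W + 1 / W"
         "(real n - real t) / W = (real (n+1) - real t) / W - 1 / W"
        by (simp_all add: add_divide_distrib diff_divide_distrib)
      have "\<bar>u t\<bar> \<le> 16 * (1 / W)\<^sup>2"
        unfolding u_def \<phi>_def eqs by (rule bump_second_diff_le[OF h])
      then show "\<bar>\<epsilon> t * u t\<bar> \<le> E * (16 * (1 / W)\<^sup>2)"
        unfolding abs_mult using \<epsilon>E[OF t] E0 by (intro mult_mono) auto
    qed (use E0 W in auto)
    also have "\<dots> = 1 / (2 * (real N)\<^sup>2)" using W by (simp add: E_def power2_eq_square)
    finally show ?thesis .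
  qed
  have "unif_convex N a"
    unfolding unif_convex_def
  proof (intro conjI allI impI)
    fix n assume n: "1 \<le> n \<and> n + 1 \<le> N"
    then show "a (n+1) - a n \<in> {1 / (4 * real N) .. 4 / real N}"
      using g1[of n] base_seq_step[of n N] by (simp add: a_def abs_le_iff field_simps)
  next
    fix n assume n: "1 \<le> n \<and> n + 2 \<le> N"
    have "(base_seq N (n+2) - base_seq N (n+1)) - (base_seq N (n+1) - base_seq N n) = 1 / (real N)\<^sup>2"
      using N by (simp add: base_seq_def field_simps power2_eq_square)
    then show "(a (n+2) - a (n+1)) - (a (n+1) - a n) \<in> {1 / (4 * real N ^ 2) .. 4 / real N ^ 2}"
      using g2[of n] by (simp add: a_def abs_le_iff field_simps)
  qed
  then show ?thesis using at by blast
qed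

text \<open>Reduces both lower bounds to exhibiting a large separated set \<open>T\<close>.\<close>

lemma lattice_count_through:
  fixes W :: real
  assumes "N \<ge> 1" "4 \<le> W" "W \<le> real N" and T: "T \<subseteq> {1..N}"
    and near: "\<And>t. t \<in> T \<Longrightarrow> \<exists>k::int. \<bar>of_int k * real N powr (-\<alpha>) - base_seq N t\<bar> \<le> W\<^sup>2 / (32 * (real N)\<^sup>2)"
    and sep: "\<And>s t. s \<in> T \<Longrightarrow> t \<in> T \<Longrightarrow> s < t \<Longrightarrow> 4 * W \<le> real t - real s"
  shows "\<exists>a. unif_convex N a \<and> card T \<le> lattice_count N a \<alpha>"
proof -
  obtain k :: "nat \<Rightarrow> int" where k: "\<And>t. t \<in> T \<Longrightarrow>
      \<bar>of_int (k t) * real N powr (-\<alpha>) - base_seq N t\<bar> \<le> W\<^sup>2 / (32 * (real N)\<^sup>2)"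
    using near by metis
  have "finite T" using T by (rule finite_subset) simp
  from unif_convex_through[OF assms(1-3) this k sep]
  obtain a where a: "unif_convex N a" "\<And>t. t \<in> T \<Longrightarrow> a t = of_int (k t) * real N powr (-\<alpha>)"
    by blast
  have "T \<subseteq> {n \<in> {1..N}. a n \<in> scaled_lattice N \<alpha>}"
    using T a(2) by (auto simp: scaled_lattice_def)
  then have "card T \<le> lattice_count N a \<alpha>"
    unfolding lattice_count_eq[OF a(1)] by (intro card_mono) auto
  then show ?thesis using a(1) by blast
qed

text \<open>Uniform convexity is translation invariant and 0 lies in every lattice. This settles the
  cases where the target is at most 1600.\<close>

lemma exists_unif_convex_count_ge_1:
  assumes "N \<ge> 4"
  shows "\<exists>a. unif_convex N a \<and> 1 \<le> lattice_count N a \<alpha>"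
proof -
  obtain a0 where a0: "unif_convex N a0"
    using unif_convex_through[of N 4 "{}" "\<lambda>_. 0"] assms by auto
  define a where "a n = a0 n - a0 1" for n
  have uc: "unif_convex N a" using a0 by (simp add: unif_convex_def a_def)
  have "{1} \<subseteq> {n \<in> {1..N}. a n \<in> scaled_lattice N \<alpha>}"
    using assms by (auto simp: a_def scaled_lattice_def)
  then have "card {1::nat} \<le> lattice_count N a \<alpha>"
    unfolding lattice_count_eq[OF uc] by (intro card_mono) auto
  then show ?thesis using uc by auto
qed

section \<open>Fine lattices: rational approximation of the slope\<close>

text \<open>Replace \<open>s\<close> by \<open>q / p\<close> and round \<open>p * G\<close> down to
  \<open>u\<close>. As \<open>q\<close> is invertible modulo \<open>p\<close>, some
  \<open>t < p\<close> makes \<open>t * q + u\<close> divisible by \<open>p\<close>. Rounding costs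
  \<open>1 / p\<close>, and the slope error, accumulated over \<open>t < p\<close> steps, at most
  \<delta>.\<close>

lemma near_integer_in_progression:
  fixes G s \<delta> :: real and p q :: int
  assumes "coprime q p" "0 < p" and \<delta>: "\<bar>of_int p * s - of_int q\<bar> \<le> \<delta>"
  shows "\<exists>t::nat. int t < p \<and> (\<exists>k::int. \<bar>G + real t * s - of_int k\<bar> \<le> 1 / of_int p + \<delta>)"
proof -
  define u where "u = \<lfloor>of_int p * G\<rfloor>"
  obtain x y where xy: "x * q + y * p = 1"
    using bezout_int[of q p] assms(1) by auto
  \<comment> \<open>The Bezout coefficient \<open>x\<close> is an inverse of \<open>q\<close> modulo
    \<open>p\<close>.\<close>
  define t where "t = nat ((- u * x) mod p)"
  have t: "int t = (- u * x) mod p" using assms(2) by (simp add: t_def)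
  have tp: "int t < p" using assms(2) t by simp
  define m where "m = (- u * x) div p"
  have tm: "int t = - u * x - m * p" using t by (simp add: m_def minus_div_mult_eq_mod)
  have "int t * q + u = u * (1 - x * q) - m * q * p" unfolding tm by (simp add: algebra_simps)
  also have "1 - x * q = y * p" using xy by simp
  finally have "int t * q + u = (u * y - m * q) * p" by (simp add: algebra_simps)
  then obtain k where "int t * q + u = k * p" by blast
  then have "real_of_int (int t * q + u) = real_of_int (k * p)" by (rule arg_cong)
  then have k: "real_of_int u = of_int k * of_int p - real t * of_int q" by simp
  have p0: "0 < real_of_int p" using assms(2) by simp
  have eq: "G + real t * s - of_int k =
      (of_int p * G - of_int u) / of_int p + real t / of_int p * (of_int p * s - of_int q)"
    unfolding k using p0 by (simp add: field_simps)
  have "0 \<le> of_int p * G - of_int u" "of_int p * G - of_int u \<le> 1" unfolding u_def by linarith+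
  then have "\<bar>(of_int p * G - of_int u) / of_int p\<bar> \<le> 1 / of_int p"
    using p0 by (simp add: divide_right_mono abs_divide)
  moreover have "\<bar>real t / of_int p * (of_int p * s - of_int q)\<bar> \<le> 1 * \<delta>"
    unfolding abs_mult using tp p0 \<delta> by (intro mult_mono) (auto simp: abs_divide field_simps)
  ultimately have "\<bar>G + real t * s - of_int k\<bar> \<le> 1 / of_int p + \<delta>" unfolding eq by linarith
  then show ?thesis using tp by blast
qed

lemma card_progression_near_le:
  fixes \<beta> \<gamma> r :: real
  assumes "finite A" "0 < \<beta>" "0 \<le> r" and near: "\<And>j::nat. j \<in> A \<Longrightarrow> \<bar>\<beta> * real j + \<gamma>\<bar> \<le> r"
  shows "real (card A) \<le> 2 * r / \<beta> + 1"
proof (cases "A = {}")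
  case False
  have "Min A \<le> Max A" using False assms(1) by simp
  have "card A \<le> card {Min A..Max A}" using assms(1) by (intro card_mono) auto
  then have "real (card A) \<le> real (Max A) - real (Min A) + 1"
    using \<open>Min A \<le> Max A\<close> by simp
  moreover have "\<beta> * (real (Max A) - real (Min A)) \<le> 2 * r"
    using near[of "Max A"] near[of "Min A"] False assms(1) Max_in[of A] Min_in[of A]
    by (simp add: abs_le_iff right_diff_distrib)
  then have "real (Max A) - real (Min A) \<le> 2 * r / \<beta>" using assms(2) by (simp add: field_simps)
  ultimately show ?thesis by simp
qed (use assms in simp)

text \<open>\<open>D\<close> is the block length and \<open>S + \<kappa> * (real j * D)\<close> the slope at the start of block \<open>j\<close>.\<close>

lemma card_small_denominator_le:
  fixes P S \<kappa> D :: real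
  assumes P: "1 \<le> P" and S: "1 \<le> S * P" and \<kappa>: "\<kappa> * P ^ 3 = 1" and D: "256 * P \<le> D"
    and fin: "finite B"
    and bad: "\<And>j. j \<in> B \<Longrightarrow> S + \<kappa> * (real j * D) \<le> 2 * S \<and>
      (\<exists>p q::int. 0 < p \<and> of_int p \<le> P / 64 \<and> \<bar>of_int p * (S + \<kappa> * (real j * D)) - of_int q\<bar> < 1 / P)"
  shows "real (card B) \<le> 9 / 8192 * (S * P\<^sup>2)"
proof -
  define s where "s j = S + \<kappa> * (real j * D)" for j :: nat
  define C where "C p q = {j \<in> B. \<bar>of_int p * s j - of_int q\<bar> \<le> 1 / P}" for p q :: int
  define Ps where "Ps = {1..\<lfloor>P / 64\<rfloor>}"
  define Qs where "Qs p = {1..\<lfloor>3 * of_int p * S\<rfloor>}" for p :: int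
  have P0: "0 < P" using P by simp
  have \<kappa>0: "0 < \<kappa>" using \<kappa> P0 by (metis zero_less_mult_iff zero_less_power zero_less_one not_less_iff_gr_or_eq)
  have D0: "0 < D" using D P by simp
  have S0: "0 < S" using S P0 by (metis zero_less_mult_iff less_le_trans zero_less_one not_less_iff_gr_or_eq)
  have PS: "1 / P \<le> S" using S P0 by (simp add: field_simps)
  \<comment> \<open>A bad slope lies between \<open>S\<close> and \<open>2 * S\<close>; together
    with \<open>1 / P \<le> S\<close> this confines the numerator \<open>q\<close> to the range from
    1 to \<open>3 * p * S\<close>.\<close>
  have cover: "B \<subseteq> (\<Union>p\<in>Ps. \<Union>q\<in>Qs p. C p q)"
  proof
    fix j assume j: "j \<in> B"
    then obtain p q :: int where pq: "0 < p" "of_int p \<le> P / 64" "\<bar>of_int p * s j - of_int q\<bar> < 1 / P"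
      using bad unfolding s_def by blast
    have p1: "1 \<le> real_of_int p" using pq by simp
    have "S \<le> s j" using \<kappa>0 D0 by (simp add: s_def)
    then have "S \<le> of_int p * s j" using mult_mono[OF p1, of S "s j"] S0 p1 by simp
    then have "0 < real_of_int q" using pq(3) PS by linarith
    then have q: "1 \<le> q" by simp
    have "S \<le> of_int p * S" using p1 S0 by simp
    moreover have "of_int p * s j \<le> of_int p * (2 * S)"
      using bad[OF j] p1 unfolding s_def by (intro mult_left_mono) auto
    ultimately have "real_of_int q \<le> 3 * of_int p * S" using pq(3) PS by linarith
    then have "q \<in> Qs p" using q by (simp add: Qs_def le_floor_iff)
    moreover have "p \<in> Ps" using pq by (simp add: Ps_def le_floor_iff)
    moreover have "j \<in> C p q" using j pq by (simp add: C_def)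
    ultimately show "j \<in> (\<Union>p\<in>Ps. \<Union>q\<in>Qs p. C p q)" by blast
  qed
  \<comment> \<open>For fixed \<open>p\<close> and \<open>q\<close> the numbers
    \<open>p * s j\<close> lie on a progression with step at least \<open>256 * p / P ^ 2\<close>
    and must hit a window of length \<open>2 / P\<close>.\<close>
  have cardC: "real (card (C p q)) \<le> P / (128 * of_int p) + 1" if "p \<in> Ps" for p q
  proof -
    have p0: "0 < real_of_int p" using that by (simp add: Ps_def)
    have "real (card (C p q)) \<le> 2 * (1 / P) / (of_int p * \<kappa> * D) + 1"
    proof (rule card_progression_near_le)
      show "\<bar>of_int p * \<kappa> * D * real j + (of_int p * S - of_int q)\<bar> \<le> 1 / P" if "j \<in> C p q" for j
        using that by (simp add: C_def s_def algebra_simps)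
    qed (use fin p0 \<kappa>0 D0 P0 in \<open>auto simp: C_def\<close>)
    also have "2 * (1 / P) / (of_int p * \<kappa> * D) \<le> 2 * (1 / P) / (of_int p * \<kappa> * (256 * P))"
      using p0 \<kappa>0 D P0 by (intro divide_left_mono mult_left_mono) auto
    also have "\<dots> = P / (128 * of_int p)"
    proof -
      have "\<kappa> = 1 / P ^ 3" using \<kappa> P0 by (simp add: field_simps)
      show ?thesis unfolding \<open>\<kappa> = 1 / P ^ 3\<close> using p0 P0 by (simp add: field_simps power3_eq_cube)
    qed
    finally show ?thesis by simp
  qed
  have cardQ: "real (card (\<Union>q\<in>Qs p. C p q)) \<le> 9 / 128 * (S * P)" if p: "p \<in> Ps" for p
  proof -
    have p0: "0 < real_of_int p" "real_of_int p \<le> P / 64" using p by (auto simp: Ps_def le_floor_iff)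
    have "real (card (\<Union>q\<in>Qs p. C p q)) \<le> real (\<Sum>q\<in>Qs p. card (C p q))"
      by (intro of_nat_mono card_UN_le) (simp add: Qs_def)
    also have "\<dots> \<le> (\<Sum>q\<in>Qs p. P / (128 * of_int p) + 1)"
      unfolding of_nat_sum by (intro sum_mono cardC p)
    also have "\<dots> = of_int \<lfloor>3 * of_int p * S\<rfloor> * (P / (128 * of_int p) + 1)"
      using p0 S0 by (simp add: Qs_def)
    also have "\<dots> \<le> (3 * of_int p * S) * (P / (128 * of_int p) + 1)"
      using p0 P0 by (intro mult_right_mono) auto
    also have "\<dots> = 3 / 128 * (S * P) + 3 * S * of_int p" using p0 by (simp add: field_simps)
    \<comment> \<open>Here \<open>3 / 128 + 3 / 64 = 9 / 128\<close>; the at most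
      \<open>P / 64\<close> denominators then give \<open>9 / 8192\<close>.\<close>
    also have "\<dots> \<le> 3 / 128 * (S * P) + 3 * S * (P / 64)"
      using p0 S0 by (intro add_left_mono mult_left_mono) auto
    finally show ?thesis by (simp add: mult_ac)
  qed
  have "real (card B) \<le> real (card (\<Union>p\<in>Ps. \<Union>q\<in>Qs p. C p q))"
    using cover fin by (intro of_nat_mono card_mono) (auto simp: Ps_def Qs_def C_def)
  also have "\<dots> \<le> real (\<Sum>p\<in>Ps. card (\<Union>q\<in>Qs p. C p q))"
    by (intro of_nat_mono card_UN_le) (simp add: Ps_def)
  also have "\<dots> \<le> (\<Sum>p\<in>Ps. 9 / 128 * (S * P))"
    unfolding of_nat_sum by (intro sum_mono cardQ)
  also have "\<dots> = of_int \<lfloor>P / 64\<rfloor> * (9 / 128 * (S * P))" using P0 by (simp add: Ps_def)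
  also have "\<dots> \<le> P / 64 * (9 / 128 * (S * P))"
    using P0 S0 by (intro mult_right_mono of_int_floor_le) auto
  finally show ?thesis by (simp add: power2_eq_square mult_ac)
qed

text \<open>Exact Taylor expansion at \<open>x\<close>, measured in units of
  \<open>1 / (S * N)\<close>, the lattice spacing in the application.\<close>

lemma base_seq_add:
  assumes "N \<ge> 1"
  shows "S * real N * base_seq N (x + t) = S * real N * base_seq N x
    + real t * (S + S / real N * real x) + S / real N * (real t)\<^sup>2 / 2"
  using assms by (simp add: base_seq_def field_simps power2_eq_square)

text \<open>The relation \<open>S * P ^ 3 = N\<close> makes the curvature \<kappa> equal to
  \<open>1 / P ^ 3\<close>. Over \<open>2 * P\<close> steps the quadratic term is then
  \<open>O(1 / P)\<close>, the same order as the errors from rounding and from the slope.\<close>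

lemma many_near_lattice_points:
  fixes P S :: real
  assumes N: "N \<ge> 1" and P: "1 \<le> P" and SP: "1 \<le> S * P" and SPN: "S * P ^ 3 = real N"
    and large: "1600 * P \<le> real N"
  shows "\<exists>T \<subseteq> {1..N}. real N \<le> 1600 * P * real (card T) \<and>
    (\<forall>s\<in>T. \<forall>t\<in>T. s < t \<longrightarrow> 192 * P \<le> real t - real s) \<and>
    (\<forall>t\<in>T. \<exists>k::int. \<bar>S * real N * base_seq N t - of_int k\<bar> \<le> 67 / P)"
proof -
  define D where "D = nat \<lceil>256 * P\<rceil>"
  \<comment> \<open>Block \<open>j\<close> runs from \<open>j * D\<close> to
    \<open>(j + 1) * D\<close>. Starting at block 1 keeps indices positive, and the
    \<open>- 1\<close> keeps the last block inside \<open>N\<close>.\<close>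
  define J where "J = N div D - 1"
  define \<kappa> where "\<kappa> = S / real N"
  define s where "s j = S + \<kappa> * (real j * real D)" for j :: nat
  have P0: "0 < P" using P by simp
  have S0: "0 < S" using SP P0 by (metis zero_less_mult_iff less_le_trans zero_less_one not_less_iff_gr_or_eq)
  have D: "256 * P \<le> real D" "real D \<le> 257 * P" using P by (auto simp: D_def le_nat_iff) linarith+
  have \<kappa>0: "0 < \<kappa>" using S0 N by (simp add: \<kappa>_def)
  have \<kappa>P: "\<kappa> * P ^ 3 = 1" using SPN N by (simp add: \<kappa>_def)
  have \<kappa>N: "\<kappa> * real N = S" using N by (simp add: \<kappa>_def)
  have jD: "(j + 1) * D \<le> N" if "1 \<le> j" "j \<le> J" for j
  proof -
    have "j + 1 \<le> N div D" using that by (simp add: J_def)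
    then have "(j + 1) * D \<le> N div D * D" by (rule mult_le_mono1)
    also have "\<dots> \<le> N" by simp
    finally show ?thesis .
  qed
  have s2: "s j \<le> 2 * S" if "1 \<le> j" "j \<le> J" for j
  proof -
    have "j * D \<le> N" using jD[OF that] by simp
    then have "real j * real D \<le> real N" by (metis of_nat_le_iff of_nat_mult)
    then have "\<kappa> * (real j * real D) \<le> \<kappa> * real N" using \<kappa>0 by (intro mult_left_mono) auto
    then show ?thesis unfolding \<kappa>N by (simp add: s_def)
  qed
  have "\<exists>p q. coprime q p \<and> 0 < p \<and> real_of_int p \<le> 2 * P \<and> \<bar>of_int p * s j - of_int q\<bar> < 1 / P" for j
  proof -
    define n where "n = nat \<lceil>P\<rceil>"
    have n: "P \<le> real n" "real n \<le> 2 * P" "0 < n" using P by (auto simp: n_def) linarith+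
    obtain q p where pq: "coprime q p" "0 < p" "p \<le> int n" "\<bar>of_int p * s j - of_int q\<bar> < 1 / real n"
      using Dirichlet_approx_coprime[OF n(3)] by metis
    have "1 / real n \<le> 1 / P" using n P0 by (intro divide_left_mono) auto
    moreover have "real_of_int p \<le> real n" using pq(3) by linarith
    ultimately show ?thesis using pq n by force
  qed
  then obtain p q where pq: "\<And>j. coprime (q j) (p j)" "\<And>j. 0 < p j" "\<And>j. real_of_int (p j) \<le> 2 * P"
      "\<And>j. \<bar>of_int (p j) * s j - of_int (q j)\<bar> < 1 / P"
    by metis
  define B where "B = {j\<in>{1..J}. real_of_int (p j) \<le> P / 64}"
  define G where "G = {j\<in>{1..J}. P / 64 < real_of_int (p j)}"
  have cardB: "real (card B) \<le> 9 / 8192 * (S * P\<^sup>2)"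
  proof (rule card_small_denominator_le[OF P SP \<kappa>P D(1)])
    fix j assume "j \<in> B"
    then show "S + \<kappa> * (real j * real D) \<le> 2 * S \<and> (\<exists>p q::int. 0 < p \<and> of_int p \<le> P / 64 \<and>
        \<bar>of_int p * (S + \<kappa> * (real j * real D)) - of_int q\<bar> < 1 / P)"
      using pq(2,4)[of j] s2[of j] unfolding s_def B_def by auto
  qed (simp add: B_def)
  have "\<exists>t::nat. int t < p j \<and> (\<exists>k::int. \<bar>S * real N * base_seq N (j * D) + real t * s j - of_int k\<bar>
      \<le> 1 / of_int (p j) + 1 / P)" for j
    using near_integer_in_progression[OF pq(1) pq(2) less_imp_le[OF pq(4)]] .
  then obtain \<tau> where \<tau>: "\<And>j. int (\<tau> j) < p j" "\<And>j. \<exists>k::int.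
      \<bar>S * real N * base_seq N (j * D) + real (\<tau> j) * s j - of_int k\<bar> \<le> 1 / of_int (p j) + 1 / P"
    by metis
  define pt where "pt j = j * D + \<tau> j" for j
  have \<tau>P: "real (\<tau> j) \<le> 2 * P" for j
  proof -
    have "real (\<tau> j) < real_of_int (p j)" using \<tau>(1)[of j] by linarith
    then show ?thesis using pq(3)[of j] by simp
  qed
  have sep: "192 * P \<le> real (pt j) - real (pt i)" if "i < j" for i j
  proof -
    have "(i + 1) * D \<le> j * D" using that by (intro mult_le_mono1) simp
    then have "real ((i + 1) * D) \<le> real (j * D)" by (rule of_nat_mono)
    then have "real (i * D) + real D \<le> real (j * D)" by (simp add: algebra_simps)
    then show ?thesis using \<tau>P[of i] D(1) P0 unfolding pt_def of_nat_add by linarith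
  qed
  have strict: "strict_mono pt" by (rule strict_monoI) (use sep P0 in \<open>force dest: sep\<close>)
  show ?thesis
  proof (intro exI[of _ "pt ` G"] conjI ballI impI)
    show "pt ` G \<subseteq> {1..N}"
    proof
      fix n assume "n \<in> pt ` G"
      then obtain j where j: "1 \<le> j" "j \<le> J" "n = pt j" by (auto simp: G_def)
      have "real D \<ge> 1" using D(1) P by linarith
      then have "1 \<le> D" by simp
      then have "1 \<le> j * D" using j(1) by (metis mult_le_mono nat_mult_1)
      then have "1 \<le> pt j" unfolding pt_def by linarith
      moreover have "real (\<tau> j) \<le> real D" using \<tau>P[of j] D(1) P0 by linarith
      then have "pt j \<le> (j + 1) * D" by (simp add: pt_def)
      ultimately show "n \<in> {1..N}" using j jD[of j] le_trans[of "pt j" "(j + 1) * D" N] by simp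
    qed
  next
    have D0: "0 < real D" using D(1) P0 by linarith
    then have "N < (N div D + 1) * D" using dividend_less_times_div[of D N] by (simp add: algebra_simps)
    then have "real N < real ((N div D + 1) * D)" by (rule of_nat_less_iff[THEN iffD2])
    then have "real N / real D < real (N div D) + 1" using D0 by (simp add: divide_less_eq algebra_simps)
    then have "real N / real D - 2 \<le> real J" unfolding J_def by linarith
    moreover have "real N / (257 * P) \<le> real N / real D"
      using D P0 by (intro divide_left_mono) auto
    ultimately have "real N / (257 * P) - 2 \<le> real J" by linarith
    moreover have "real J = real (card B) + real (card G)"
    proof -
      have "{1..J} = B \<union> G" "B \<inter> G = {}" by (auto simp: B_def G_def)
      then have "card {1..J} = card B + card G" by (metis card_Un_disjoint finite_Un finite_atLeastAtMost)
      then show ?thesis by simp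
    qed
    moreover have "S * P\<^sup>2 = real N / P" using SPN P0 by (simp add: field_simps power2_eq_square power3_eq_cube)
    moreover have "real N / (257 * P) = (real N / P) / 257" by simp
    moreover have "1600 \<le> real N / P" using large P0 by (simp add: field_simps)
    \<comment> \<open>With \<open>x = N / P\<close> there are at least \<open>x / 257 - 2\<close>
      blocks, at most \<open>9 / 8192 * x\<close> of them bad. Since \<open>2 \<le> x / 800\<close>,
      more than \<open>x / 1600\<close> good ones remain.\<close>
    ultimately have "real N / P \<le> 1600 * real (card G)" using cardB by linarith
    moreover have "card (pt ` G) = card G"
      using strict_mono_imp_inj_on[OF strict] by (intro card_image) (auto intro: inj_on_subset)
    ultimately show "real N \<le> 1600 * P * real (card (pt ` G))" using P0 by (simp add: field_simps)
  next
    fix m n assume "m \<in> pt ` G" "n \<in> pt ` G" "m < n"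
    then obtain i j where ij: "m = pt i" "n = pt j" by auto
    then have "i < j" using \<open>m < n\<close> strict by (simp add: strict_mono_less)
    then show "192 * P \<le> real n - real m" using sep ij by simp
  next
    fix n assume "n \<in> pt ` G"
    then obtain j where j: "P / 64 < real_of_int (p j)" "n = pt j" by (auto simp: G_def)
    obtain k :: int where k: "\<bar>S * real N * base_seq N (j * D) + real (\<tau> j) * s j - of_int k\<bar>
        \<le> 1 / of_int (p j) + 1 / P" using \<tau>(2) by blast
    have "1 / of_int (p j) \<le> 64 / P" using j P0 by (simp add: field_simps)
    moreover have "\<kappa> * (real (\<tau> j))\<^sup>2 / 2 \<le> 2 / P"
    proof -
      have "(real (\<tau> j))\<^sup>2 \<le> (2 * P)\<^sup>2" using \<tau>P by (intro power_mono) auto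
      then have "\<kappa> * (real (\<tau> j))\<^sup>2 / 2 \<le> \<kappa> * (2 * P)\<^sup>2 / 2" using \<kappa>0 by simp
      also have "\<dots> = 2 / P * (\<kappa> * P ^ 3)" using P0 by (simp add: field_simps power2_eq_square power3_eq_cube)
      finally show ?thesis unfolding \<kappa>P by simp
    qed
    moreover have "0 \<le> \<kappa> * (real (\<tau> j))\<^sup>2 / 2" using \<kappa>0 by simp
    moreover have "S * real N * base_seq N n = S * real N * base_seq N (j * D) + real (\<tau> j) * s j
        + \<kappa> * (real (\<tau> j))\<^sup>2 / 2"
      using base_seq_add[OF N, of S "j * D" "\<tau> j"] by (simp add: j pt_def s_def \<kappa>_def)
    \<comment> \<open>The three errors come from the denominator, the slope approximation and the
      curvature.\<close>
    moreover have "64 / P + 1 / P + 2 / P = 67 / P" by (simp flip: add_divide_distrib)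
    ultimately have "\<bar>S * real N * base_seq N n - of_int k\<bar> \<le> 67 / P" using k by linarith
    then show "\<exists>k::int. \<bar>S * real N * base_seq N n - of_int k\<bar> \<le> 67 / P" by blast
  qed
qed

text \<open>The exponents are chosen so that \<open>S * P ^ 3 = N\<close> and
  \<open>M * P = N\<close>; one point per \<open>1600 * P\<close> indices then yields the target
  \<open>M\<close> up to the constant.\<close>

lemma lower_bound_fine_lattice:
  assumes \<alpha>: "1/2 \<le> \<alpha>" "\<alpha> \<le> 2" and N: "N \<ge> 4"
  shows "\<exists>a. unif_convex N a \<and> real N powr ((\<alpha> + 1) / 3) \<le> 1600 * real (lattice_count N a \<alpha>)"
proof -
  define P where "P = real N powr ((2 - \<alpha>) / 3)"
  define S where "S = real N powr (\<alpha> - 1)"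
  define M where "M = real N powr ((\<alpha> + 1) / 3)"
  have N0: "0 < real N" using N by simp
  have P: "1 \<le> P" using N \<alpha> by (simp add: P_def ge_one_powr_ge_zero)
  have S0: "0 < S" using N by (simp add: S_def)
  have "S * P = real N powr (\<alpha> - 1 + (2 - \<alpha>) / 3)" by (simp only: S_def P_def powr_add)
  also have "1 \<le> \<dots>" using N \<alpha> by (intro ge_one_powr_ge_zero) (auto simp: field_simps)
  finally have SP: "1 \<le> S * P" .
  have "P ^ 3 = real N powr ((2 - \<alpha>) / 3 * real 3)" 
    unfolding P_def by (subst powr_power) (use N0 in \<open>simp_all add: mult.commute\<close>)
  also have "(2 - \<alpha>) / 3 * real 3 = 2 - \<alpha>" by simp
  finally have P3: "P ^ 3 = real N powr (2 - \<alpha>)" .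
  have "S * P ^ 3 = real N powr (\<alpha> - 1 + (2 - \<alpha>))" by (simp only: S_def P3 powr_add)
  then have SPN: "S * P ^ 3 = real N" using N0 by simp
  have "M * P = real N powr ((\<alpha> + 1) / 3 + (2 - \<alpha>) / 3)" by (simp only: M_def P_def powr_add)
  also have "(\<alpha> + 1) / 3 + (2 - \<alpha>) / 3 = 1" by (simp add: field_simps)
  finally have MP: "M * P = real N" using N0 by simp
  show ?thesis
  proof (cases "1600 * P \<le> real N")
    \<comment> \<open>Here the target is at most 1600, so a single lattice point suffices.\<close>
    case False
    then have "M * P \<le> 1600 * P" using MP by simp
    then have "M \<le> 1600" using P by simp
    moreover obtain a where "unif_convex N a" "1 \<le> lattice_count N a \<alpha>"
      using exists_unif_convex_count_ge_1[OF N] by blast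
    ultimately show ?thesis unfolding M_def[symmetric] by force
  next
    case True
    obtain T where T: "T \<subseteq> {1..N}" "real N \<le> 1600 * P * real (card T)"
      and sep: "\<And>s t. s \<in> T \<Longrightarrow> t \<in> T \<Longrightarrow> s < t \<Longrightarrow> 192 * P \<le> real t - real s"
      and near: "\<And>t. t \<in> T \<Longrightarrow> \<exists>k::int. \<bar>S * real N * base_seq N t - of_int k\<bar> \<le> 67 / P"
      using many_near_lattice_points[OF _ P SP SPN True] N by force
    have d: "real N powr (-\<alpha>) = P ^ 3 / (real N)\<^sup>2"
      using N0 by (simp add: P3 powr_diff powr_minus field_simps)
    have dS: "real N powr (-\<alpha>) * (S * real N) = 1"
      using N0 by (simp add: S_def powr_diff powr_minus field_simps)
    have "\<exists>a. unif_convex N a \<and> card T \<le> lattice_count N a \<alpha>"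
    \<comment> \<open>An error \<open>67 / P\<close> in lattice units is
      \<open>67 * P ^ 2 / N ^ 2\<close>, and this width allows \<open>48 ^ 2 / 32 = 72\<close> in
      place of 67. The separation \<open>192 * P\<close> is exactly \<open>4 * W\<close>.\<close>
    proof (rule lattice_count_through[where W = "48 * P"])
      fix t assume "t \<in> T"
      then obtain k :: int where k: "\<bar>S * real N * base_seq N t - of_int k\<bar> \<le> 67 / P" using near by blast
      have "of_int k * real N powr (-\<alpha>) - base_seq N t
          = - (real N powr (-\<alpha>)) * (S * real N * base_seq N t - of_int k)"
        using dS by (simp add: algebra_simps)
      also have "\<bar>\<dots>\<bar> \<le> real N powr (-\<alpha>) * (67 / P)"
        unfolding abs_mult abs_minus_cancel using k by (intro mult_mono) auto
      also have "\<dots> = 67 * P\<^sup>2 / (real N)\<^sup>2"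
        unfolding d using P by (simp add: power2_eq_square power3_eq_cube)
      also have "\<dots> \<le> 72 * P\<^sup>2 / (real N)\<^sup>2" by (intro divide_right_mono) auto
      also have "\<dots> = (48 * P)\<^sup>2 / (32 * (real N)\<^sup>2)" by (simp add: power2_eq_square)
      finally show "\<exists>k::int. \<bar>of_int k * real N powr (-\<alpha>) - base_seq N t\<bar>
          \<le> (48 * P)\<^sup>2 / (32 * (real N)\<^sup>2)" by blast
    qed (use N P True T(1) sep in auto)
    then obtain a where a: "unif_convex N a" "card T \<le> lattice_count N a \<alpha>" by blast
    have "M * P \<le> 1600 * real (card T) * P" using T(2) MP by (simp add: mult_ac)
    then have "M \<le> 1600 * real (card T)" using P by simp
    then show ?thesis using a unfolding M_def[symmetric] by (intro exI[of _ a]) auto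
  qed
qed

section \<open>Coarse lattices: crossings of every 66th level\<close>

lemma base_seq_diff_le:
  assumes "m \<le> n" "n \<le> N"
  shows "base_seq N n - base_seq N m \<le> 2 / real N * (real n - real m)"
  using assms
proof (induction n rule: dec_induct)
  case (step n)
  then show ?case using base_seq_step(2)[of n N] by (simp add: algebra_simps add_divide_distrib diff_divide_distrib)
qed simp

text \<open>Steps are at most \<open>2 / N\<close>, so the first index reaching a level overshoots
  it by at most \<open>2 / N\<close>, just what bumps of width \<open>8 * sqrt N\<close> can
  correct. The bound on \<alpha> gives \<open>sqrt N \<le> N * d\<close>, which separates the
  crossings.\<close>

lemma lower_bound_coarse_lattice:
  assumes \<alpha>: "0 \<le> \<alpha>" "\<alpha> \<le> 1/2" and N: "N \<ge> 4"
  shows "\<exists>a. unif_convex N a \<and> real N powr \<alpha> \<le> 1600 * real (lattice_count N a \<alpha>)"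
proof (cases "real N powr \<alpha> \<le> 1600")
  case True
  moreover obtain a where "unif_convex N a" "1 \<le> lattice_count N a \<alpha>"
    using exists_unif_convex_count_ge_1[OF N] by blast
  ultimately show ?thesis by force
next
  case False
  define M where "M = real N powr \<alpha>"
  define d where "d = real N powr (-\<alpha>)"
  define l where "l j = 66 * real j * d" for j :: nat
  \<comment> \<open>The top level is at most \<open>M * d = 1\<close>, while \<open>base_seq\<close>
    climbs from 0 to \<open>3 / 2\<close>, so every level is reached.\<close>
  define J where "J = nat \<lfloor>M / 66\<rfloor>"
  define g where "g j = (LEAST n. l j \<le> base_seq N n)" for j
  have N0: "0 < real N" using N by simp
  have M: "1600 < M" using False by (simp add: M_def)
  have d0: "0 < d" using N by (simp add: d_def)
  have Md: "M * d = 1" using N by (simp add: M_def d_def powr_minus)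
  have "M \<le> real N powr 1" unfolding M_def using N \<alpha> by (intro powr_mono) auto
  then have N1600: "1600 < real N" using M N0 by simp
  have sqrt40: "40 \<le> sqrt (real N)" using N1600 by (intro real_le_rsqrt) (simp add: power2_eq_square)
  have sqsq: "sqrt (real N) * sqrt (real N) = real N" by simp
  have "sqrt (real N) = real N powr (1/2)" using N0 by (simp add: powr_half_sqrt)
  also have "\<dots> \<le> real N powr (1 - \<alpha>)" using N \<alpha> by (intro powr_mono) auto
  also have "\<dots> = real N * d" using N0 by (simp add: d_def powr_diff powr_minus field_simps)
  finally have Nd: "sqrt (real N) \<le> real N * d" .
  have ex: "l j \<le> base_seq N N" if "j \<le> J" for j
  proof -
    have "real j \<le> M / 66" using that M unfolding J_def by linarith
    then have "l j \<le> 66 * (M / 66) * d" unfolding l_def using d0 by (intro mult_right_mono mult_left_mono) auto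
    also have "\<dots> = 1" using Md by simp
    also have "1 \<le> base_seq N N" using N by (simp add: base_seq_def)
    finally show ?thesis .
  qed
  have g: "l j \<le> base_seq N (g j)" "g j \<le> N" if "j \<le> J" for j
    unfolding g_def using LeastI[of "\<lambda>n. l j \<le> base_seq N n", OF ex[OF that]]
      Least_le[of "\<lambda>n. l j \<le> base_seq N n", OF ex[OF that]] by auto
  have g1: "1 \<le> g j" if "1 \<le> j" "j \<le> J" for j
  proof (rule ccontr)
    assume "\<not> 1 \<le> g j"
    then have "g j = 0" by simp
    then have "l j \<le> 0" using g(1)[OF that(2)] by (simp add: base_seq_def)
    then show False using d0 that by (simp add: l_def mult_le_0_iff)
  qed
  have upper: "base_seq N (g j) \<le> l j + 2 / real N" if "1 \<le> j" "j \<le> J" for j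
  proof -
    have "\<not> l j \<le> base_seq N (g j - 1)"
      using not_less_Least[of "g j - 1" "\<lambda>n. l j \<le> base_seq N n"] g1[OF that] unfolding g_def by simp
    moreover have "base_seq N (g j) - base_seq N (g j - 1) \<le> 2 / real N"
      using base_seq_step(2)[of "g j - 1" N] g(2)[of j] g1[of j] that by simp
    ultimately show ?thesis by simp
  qed
  have mono: "g i \<le> g j" if "i \<le> j" "j \<le> J" for i j
  proof -
    have "l i \<le> l j" using that d0 by (simp add: l_def)
    then show ?thesis using g(1)[OF that(2)] unfolding g_def[of i] by (intro Least_le) simp
  qed
  \<comment> \<open>Climbing \<open>66 * d\<close> takes at least \<open>33 * N * d - 1\<close>
    indices, the \<open>- 1\<close> accounting for the overshoot at level \<open>i\<close>. Hence
    66: the result must exceed \<open>4 * W = 32 * sqrt N\<close>.\<close>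
  have gap: "32 * sqrt (real N) \<le> real (g j) - real (g i)" if "1 \<le> i" "i < j" "j \<le> J" for i j
  proof -
    have "1 * (66 * d) \<le> (real j - real i) * (66 * d)" using that d0 by (intro mult_right_mono) auto
    then have "66 * d \<le> l j - l i" by (simp add: l_def algebra_simps)
    also have "\<dots> \<le> base_seq N (g j) - base_seq N (g i) + 2 / real N"
      using g(1)[of j] upper[of i] that by simp
    also have "base_seq N (g j) - base_seq N (g i) \<le> 2 / real N * (real (g j) - real (g i))"
      using base_seq_diff_le mono[of i j] g(2)[of j] that by simp
    finally have "33 * (real N * d) \<le> real (g j) - real (g i) + 1" using N0 by (simp add: field_simps)
    then show ?thesis using Nd sqrt40 by linarith
  qed
  have less: "g i < g j" if "1 \<le> i" "i < j" "j \<le> J" for i j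
    using gap[OF that] sqrt40 by linarith
  have inj: "inj_on g {1..J}"
    by (rule linorder_inj_onI) (use less in force)+
  have "\<exists>a. unif_convex N a \<and> card (g ` {1..J}) \<le> lattice_count N a \<alpha>"
  proof (rule lattice_count_through[where W = "8 * sqrt (real N)"])
    show "g ` {1..J} \<subseteq> {1..N}" using g1 g(2) by auto
    show "8 * sqrt (real N) \<le> real N"
    proof -
      have "8 * sqrt (real N) \<le> sqrt (real N) * sqrt (real N)" using sqrt40 by (intro mult_right_mono) auto
      then show ?thesis by simp
    qed
  next
    fix t assume "t \<in> g ` {1..J}"
    then obtain j where j: "1 \<le> j" "j \<le> J" "t = g j" by auto
    have "(8 * sqrt (real N))\<^sup>2 / (32 * (real N)\<^sup>2) = 2 / real N"
      using N0 by (simp add: power_mult_distrib power2_eq_square)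
    moreover have "of_int (66 * int j) * real N powr (-\<alpha>) = l j" by (simp add: l_def d_def)
    moreover have "\<bar>l j - base_seq N t\<bar> \<le> 2 / real N" using g(1)[of j] upper[of j] j by simp
    ultimately show "\<exists>k::int. \<bar>of_int k * real N powr (-\<alpha>) - base_seq N t\<bar>
        \<le> (8 * sqrt (real N))\<^sup>2 / (32 * (real N)\<^sup>2)" by metis
  next
    fix s t assume "s \<in> g ` {1..J}" "t \<in> g ` {1..J}" "s < t"
    then obtain i j where ij: "1 \<le> i" "i \<le> J" "1 \<le> j" "j \<le> J" "s = g i" "t = g j" by auto
    then have "i < j" using mono[of j i] \<open>s < t\<close> by (cases "i < j") auto
    then show "4 * (8 * sqrt (real N)) \<le> real t - real s" using gap ij by simp
  qed (use N sqrt40 in auto)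
  moreover have "M \<le> 1600 * real (card (g ` {1..J}))"
  proof -
    have "M / 66 - 1 \<le> real J" unfolding J_def by linarith
    then show ?thesis unfolding card_image[OF inj] using M by simp
  qed
  ultimately show ?thesis unfolding M_def by (meson mult_left_mono of_nat_mono order_trans zero_le_numeral)
qed

section \<open>Combining the lower and upper bounds\<close>

theorem theorem3:
  shows "\<exists>c::real. c > 0 \<and>
    (\<forall>\<alpha>::real. \<forall>N::nat. 1/2 \<le> \<alpha> \<and> \<alpha> \<le> 2 \<and> N \<ge> 10 \<longrightarrow>
       (\<exists>a. unif_convex N a \<and>
            real (lattice_count N a \<alpha>) \<ge> c * real N powr ((\<alpha> + 1) / 3))) \<and>
    (\<forall>\<alpha>::real. \<forall>N::nat. 0 \<le> \<alpha> \<and> \<alpha> \<le> 1/2 \<and> N \<ge> 10 \<longrightarrow>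
       (\<exists>a. unif_convex N a \<and>
            real (lattice_count N a \<alpha>) \<ge> c * real N powr \<alpha>)) \<and>
    (\<forall>\<epsilon>::real. \<epsilon> > 0 \<longrightarrow> (\<exists>C::real. C > 0 \<and>
       (\<forall>N::nat. \<forall>a. \<forall>\<alpha>::real. N \<ge> 1 \<and> unif_convex N a \<and> 0 \<le> \<alpha> \<and> \<alpha> \<le> 2 \<longrightarrow>
          (1/2 \<le> \<alpha> \<longrightarrow>
             real (lattice_count N a \<alpha>) \<le> C * real N powr \<epsilon> * real N powr ((\<alpha> + 1) / 3)) \<and>
          (\<alpha> \<le> 1/2 \<longrightarrow>
             real (lattice_count N a \<alpha>) \<le> 100 * real N powr \<alpha>))))"
proof (rule exI[of _ "1 / 1600 :: real"], intro conjI allI impI)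
  fix \<alpha> :: real and N :: nat assume "1/2 \<le> \<alpha> \<and> \<alpha> \<le> 2 \<and> N \<ge> 10"
  then obtain a where "unif_convex N a" "real N powr ((\<alpha> + 1) / 3) \<le> 1600 * real (lattice_count N a \<alpha>)"
    using lower_bound_fine_lattice[of \<alpha> N] by auto
  then show "\<exists>a. unif_convex N a \<and> real (lattice_count N a \<alpha>) \<ge> 1 / 1600 * real N powr ((\<alpha> + 1) / 3)"
    by (intro exI[of _ a]) simp
next
  fix \<alpha> :: real and N :: nat assume "0 \<le> \<alpha> \<and> \<alpha> \<le> 1/2 \<and> N \<ge> 10"
  then obtain a where "unif_convex N a" "real N powr \<alpha> \<le> 1600 * real (lattice_count N a \<alpha>)"
    using lower_bound_coarse_lattice[of \<alpha> N] by auto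
  then show "\<exists>a. unif_convex N a \<and> real (lattice_count N a \<alpha>) \<ge> 1 / 1600 * real N powr \<alpha>"
    by (intro exI[of _ a]) simp
next
  fix \<epsilon> :: real assume \<epsilon>: "0 < \<epsilon>"
  show "\<exists>C::real. C > 0 \<and>
       (\<forall>N::nat. \<forall>a. \<forall>\<alpha>::real. N \<ge> 1 \<and> unif_convex N a \<and> 0 \<le> \<alpha> \<and> \<alpha> \<le> 2 \<longrightarrow>
          (1/2 \<le> \<alpha> \<longrightarrow>
             real (lattice_count N a \<alpha>) \<le> C * real N powr \<epsilon> * real N powr ((\<alpha> + 1) / 3)) \<and>
          (\<alpha> \<le> 1/2 \<longrightarrow>
             real (lattice_count N a \<alpha>) \<le> 100 * real N powr \<alpha>))"
  \<comment> \<open>As \<open>N powr \<epsilon>\<close> is at least 1, the constant 7 of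
    \<open>lattice_count_upper\<close> serves for every \<epsilon>.\<close>
  proof (intro exI[of _ "7 :: real"] conjI allI impI)
    fix N :: nat and a and \<alpha> :: real
    assume *: "N \<ge> 1 \<and> unif_convex N a \<and> 0 \<le> \<alpha> \<and> \<alpha> \<le> 2"
    have "1 \<le> real N powr \<epsilon>" using * \<epsilon> by (simp add: ge_one_powr_ge_zero)
    then have "7 * 1 * real N powr ((\<alpha> + 1) / 3) \<le> 7 * real N powr \<epsilon> * real N powr ((\<alpha> + 1) / 3)"
      by (intro mult_right_mono mult_left_mono) auto
    then show "real (lattice_count N a \<alpha>) \<le> 7 * real N powr \<epsilon> * real N powr ((\<alpha> + 1) / 3)"
      using lattice_count_upper[of N a \<alpha>] * unfolding mult_1_right by linarith
    have "0 \<le> real N powr \<alpha>" by simp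
    then show "real (lattice_count N a \<alpha>) \<le> 100 * real N powr \<alpha>"
      using lattice_count_upper_trivial[of N a \<alpha>] * by linarith
  qed simp
qed simp

end
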